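(* Let $n\ge1$, $x_0\in\mathbb{R}^d$, $\bar\Delta>0$. For $i\in\{1,\dots,n\}$ let $f_i:\mathbb{R}^d\to\mathbb{R}$ be in $\mathcal{C}^1$ and let $\{\widetilde f_{i,\Delta}\}_{\Delta\in(0,\bar\Delta]}$ be a class of (differentiable) models of $f_i$ that provides order-$\infty$ function accuracy of $f_i$ at $x_0$ with constant $\kappa_i^f(x_0)=0$, and order-$N_i^g$ gradient accuracy of $f_i$ at $x_0$ with constant $\kappa_i^g(x_0)$, where $N_i^g\ge0$. Put $F=f_1\cdots f_n$, $\widetilde F_\Delta=\widetilde f_{1,\Delta}\cdots\widetilde f_{n,\Delta}$ and $N_F^g=\min\{N_i^g:i=1,\dots,n\}$. Then for every $\Delta\in(0,\bar\Delta]$ $$\|\nabla F(x_0)-\nabla\widetilde F_\Delta(x_0)\|\le K_F^g(x_0)\Delta^{N_F^g},\qquad K_F^g(x_0)=\sum_{i=1}^n\left(\prod_{j\ne i}|f_j(x_0)|\right)\kappa_i^g(x_0)\bar\Delta^{N_i^g-N_F^g}.$$ In particular, $\{\widetilde F_\Delta\}_{(0,\bar\Delta]}$ provides order-$N_F^g$ gradient accuracy of $F$ at $x_0$.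
   Context: $\|\cdot\|$ is the Euclidean norm; empty products equal $1$. A class of models of $f:\mathbb{R}^d\to\mathbb{R}$ is a family of functions $\widetilde f_\Delta:\mathbb{R}^d\to\mathbb{R}$ indexed by $\Delta\in(0,\bar\Delta]$; when gradients of models appear the models are understood to be differentiable. Order-$\infty$ function accuracy of $f$ at $x_0$ with constant $0$ means $\widetilde f_\Delta(x_0)=f(x_0)$ for all $\Delta\in(0,\bar\Delta]$. For real $N\ge0$ and $\kappa\ge0$, the class provides order-$N$ gradient accuracy of $f$ at $x_0$ with constant $\kappa$ if $\|\nabla f(x_0)-\nabla\widetilde f_\Delta(x_0)\|\le\kappa\Delta^N$ for all $\Delta\in(0,\bar\Delta]$. Without mention of a constant, it is meant that some such $\kappa\ge0$ exists. *)

theory Defs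
  imports "HOL-Analysis.Analysis"
begin

text \<open>\<^term>\<open>gradient f x\<close> is unspecified where \<^term>\<open>f\<close> is not differentiable, so the notions
  below state differentiability explicitly.\<close>

definition gradient :: "(real ^ 'd \<Rightarrow> real) \<Rightarrow> real ^ 'd \<Rightarrow> real ^ 'd" where
  "gradient f x = (THE D. GDERIV f x :> D)"

definition C1 :: "(real ^ 'd \<Rightarrow> real) \<Rightarrow> bool" where
  "C1 f \<longleftrightarrow> (\<forall>x. f differentiable (at x)) \<and> continuous_on UNIV (gradient f)"

text \<open>A class of models is a function \<open>fm :: real \<Rightarrow> real ^ 'd \<Rightarrow> real\<close> of which only the values
  \<open>fm \<Delta>\<close> with \<open>\<Delta> \<in> {0<..\<Delta>max}\<close> matter.\<close>

definition differentiable_models :: "real \<Rightarrow> (real \<Rightarrow> real ^ 'd \<Rightarrow> real) \<Rightarrow> bool" where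
  "differentiable_models \<Delta>max fm \<longleftrightarrow> (\<forall>\<Delta>\<in>{0<..\<Delta>max}. \<forall>x. fm \<Delta> differentiable (at x))"

text \<open>Function accuracy of order \<open>\<infinity>\<close> with constant 0.\<close>

definition exact_function_accuracy ::
    "real \<Rightarrow> (real \<Rightarrow> real ^ 'd \<Rightarrow> real) \<Rightarrow> (real ^ 'd \<Rightarrow> real) \<Rightarrow> real ^ 'd \<Rightarrow> bool" where
  "exact_function_accuracy \<Delta>max fm f x0 \<longleftrightarrow> (\<forall>\<Delta>\<in>{0<..\<Delta>max}. fm \<Delta> x0 = f x0)"

definition gradient_accuracy_const ::
    "real \<Rightarrow> (real \<Rightarrow> real ^ 'd \<Rightarrow> real) \<Rightarrow> (real ^ 'd \<Rightarrow> real) \<Rightarrow> real ^ 'd \<Rightarrow> real \<Rightarrow> real \<Rightarrow> bool" where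
  "gradient_accuracy_const \<Delta>max fm f x0 N \<kappa> \<longleftrightarrow>
     N \<ge> 0 \<and> \<kappa> \<ge> 0 \<and> f differentiable (at x0) \<and> differentiable_models \<Delta>max fm \<and>
     (\<forall>\<Delta>\<in>{0<..\<Delta>max}. norm (gradient f x0 - gradient (fm \<Delta>) x0) \<le> \<kappa> * \<Delta> powr N)"

definition gradient_accuracy ::
    "real \<Rightarrow> (real \<Rightarrow> real ^ 'd \<Rightarrow> real) \<Rightarrow> (real ^ 'd \<Rightarrow> real) \<Rightarrow> real ^ 'd \<Rightarrow> real \<Rightarrow> bool" where
  "gradient_accuracy \<Delta>max fm f x0 N \<longleftrightarrow> (\<exists>\<kappa>. gradient_accuracy_const \<Delta>max fm f x0 N \<kappa>)"

end

theory Submission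
  imports Defs
begin

text \<open>By the product rule and exactness of the function values at \<open>x0\<close>, the gradients of the two
  products are linear combinations of the factors' gradients with the same coefficients
  \<open>\<Prod>j\<noteq>i. f j x0\<close>. Hence the triangle inequality gives an error of at most
  \<open>\<Sum>i. (\<Prod>j\<noteq>i. \<bar>f j x0\<bar>) * \<kappa> i * \<Delta> powr N i\<close>, and
  \<open>\<Delta> powr N i \<le> \<Delta>max powr (N i - NF) * \<Delta> powr NF\<close> because \<open>N i \<ge> NF\<close>.\<close>

text \<open>The derivative at a point is unique, and a vector is determined by its inner products
  with all \<open>h\<close>; so the definite description in \<open>gradient\<close> is well-defined
  as soon as some witness exists.\<close>

lemma gradient_eqI: "gradient f x = D" if "GDERIV f x :> D"
  unfolding gradient_def
proof (rule the_equality)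
  show "GDERIV f x :> D" by fact
  fix E assume "GDERIV f x :> E"
  with that have "(\<lambda>h. inner h E) = (\<lambda>h. inner h D)"
    unfolding gderiv_def by (rule has_derivative_unique[rotated])
  then show "E = D"
    by (metis vector_eq_ldot)
qed

text \<open>Riesz representation: the derivative \<open>f'\<close> is a linear functional, and
  \<open>adjoint f' 1\<close> is the vector representing it, because pairing it with
  \<open>h\<close> gives \<open>f' h * 1\<close>.\<close>

lemma GDERIV_gradient:
  assumes "f differentiable (at x)"
  shows "GDERIV f x :> gradient f x"
proof -
  obtain f' where f': "(f has_derivative f') (at x)"
    using assms unfolding differentiable_def by blast
  have "inner h (adjoint f' 1) = f' h" for h
    by (simp add: adjoint_works[OF has_derivative_linear[OF f']])
  then have "GDERIV f x :> adjoint f' 1"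
    using f' by (simp add: gderiv_def)
  then show ?thesis
    using gradient_eqI by metis
qed

text \<open>The product rule for derivatives yields a sum of functionals
  \<open>inner h (D i)\<close> with scalar weights; linearity of \<open>inner\<close> in its second
  argument collects them into a single vector.\<close>

lemma GDERIV_prod:
  assumes "\<And>i. i \<in> I \<Longrightarrow> GDERIV (f i) x :> D i"
  shows "GDERIV (\<lambda>y. \<Prod>i\<in>I. f i y) x :> (\<Sum>i\<in>I. (\<Prod>j\<in>I - {i}. f j x) *\<^sub>R D i)"
proof -
  have "((\<lambda>y. \<Prod>i\<in>I. f i y) has_derivative (\<lambda>h. \<Sum>i\<in>I. inner h (D i) * (\<Prod>j\<in>I - {i}. f j x))) (at x)"
    using assms unfolding gderiv_def by (rule has_derivative_prod)
  then show ?thesis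
    by (simp add: gderiv_def inner_sum_right mult.commute)
qed

lemma gradient_prod:
  assumes "\<And>i. i \<in> I \<Longrightarrow> f i differentiable (at x)"
  shows "gradient (\<lambda>y. \<Prod>i\<in>I. f i y) x = (\<Sum>i\<in>I. (\<Prod>j\<in>I - {i}. f j x) *\<^sub>R gradient (f i) x)"
  using assms by (intro gradient_eqI GDERIV_prod GDERIV_gradient)

text \<open>Accuracy of a class includes differentiability of the function at the point and of every
  model everywhere; this supplies both for products.\<close>

lemma differentiable_prod_at:
  fixes f :: "'i \<Rightarrow> real ^ 'd \<Rightarrow> real"
  assumes "\<And>i. i \<in> I \<Longrightarrow> f i differentiable (at x)"
  shows "(\<lambda>y. \<Prod>i\<in>I. f i y) differentiable (at x)"
proof -
  have "GDERIV (\<lambda>y. \<Prod>i\<in>I. f i y) x :> (\<Sum>i\<in>I. (\<Prod>j\<in>I - {i}. f j x) *\<^sub>R gradient (f i) x)"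
    by (intro GDERIV_prod GDERIV_gradient assms)
  then show ?thesis
    unfolding gderiv_def by (rule differentiableI)
qed

text \<open>The estimate for one fixed \<open>\<Delta>\<close>: \<open>g i\<close> stands for the
  model \<open>fm i \<Delta>\<close> and \<open>e i\<close> for its gradient error bound
  \<open>\<kappa> i * \<Delta> powr N i\<close>.\<close>

lemma norm_gradient_prod_diff_le:
  assumes "\<And>i. i \<in> I \<Longrightarrow> f i differentiable (at x)" "\<And>i. i \<in> I \<Longrightarrow> g i differentiable (at x)"
    and "\<And>i. i \<in> I \<Longrightarrow> g i x = f i x"
    and "\<And>i. i \<in> I \<Longrightarrow> norm (gradient (f i) x - gradient (g i) x) \<le> e i"
  shows "norm (gradient (\<lambda>y. \<Prod>i\<in>I. f i y) x - gradient (\<lambda>y. \<Prod>i\<in>I. g i y) x)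
    \<le> (\<Sum>i\<in>I. (\<Prod>j\<in>I - {i}. \<bar>f j x\<bar>) * e i)"
proof -
  have "gradient (\<lambda>y. \<Prod>i\<in>I. f i y) x - gradient (\<lambda>y. \<Prod>i\<in>I. g i y) x
      = (\<Sum>i\<in>I. (\<Prod>j\<in>I - {i}. f j x) *\<^sub>R (gradient (f i) x - gradient (g i) x))"
    using assms(1-3) by (simp add: gradient_prod scaleR_diff_right sum_subtractf)
  also have "norm \<dots> \<le> (\<Sum>i\<in>I. (\<Prod>j\<in>I - {i}. \<bar>f j x\<bar>) * e i)"
    using assms(4) by (intro sum_norm_le) (simp add: abs_prod mult_left_mono prod_nonneg)
  finally show ?thesis .
qed

text \<open>Split off the exponent \<open>a - b\<close>; as it is nonnegative, that factor is
  monotone in the base.\<close>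

lemma powr_le_powr_diff_mult:
  fixes a b x y :: real
  assumes "0 < x" "x \<le> y" "b \<le> a"
  shows "x powr a \<le> y powr (a - b) * x powr b"
proof -
  have "x powr a = x powr (a - b) * x powr b"
    by (simp flip: powr_add)
  also have "\<dots> \<le> y powr (a - b) * x powr b"
    using assms by (intro mult_right_mono powr_mono2) auto
  finally show ?thesis .
qed

theorem theorem16:
  fixes n :: nat
    and x0 :: "real ^ 'd"
    and \<Delta>max :: real
    and f :: "nat \<Rightarrow> real ^ 'd \<Rightarrow> real"
    and fm :: "nat \<Rightarrow> real \<Rightarrow> real ^ 'd \<Rightarrow> real"
    and N \<kappa> :: "nat \<Rightarrow> real"
    and F :: "real ^ 'd \<Rightarrow> real"
    and Fm :: "real \<Rightarrow> real ^ 'd \<Rightarrow> real"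
    and NF KF :: real
  assumes "n \<ge> 1"
    and "\<Delta>max > 0"
    and "\<And>i. i \<in> {1..n} \<Longrightarrow> C1 (f i)"
    and "\<And>i. i \<in> {1..n} \<Longrightarrow> differentiable_models \<Delta>max (fm i)"
    and "\<And>i. i \<in> {1..n} \<Longrightarrow> exact_function_accuracy \<Delta>max (fm i) (f i) x0"
    and "\<And>i. i \<in> {1..n} \<Longrightarrow> N i \<ge> 0"
    and "\<And>i. i \<in> {1..n} \<Longrightarrow> gradient_accuracy_const \<Delta>max (fm i) (f i) x0 (N i) (\<kappa> i)"
    and F_def: "F = (\<lambda>x. \<Prod>i\<in>{1..n}. f i x)"
    and Fm_def: "Fm = (\<lambda>\<Delta> x. \<Prod>i\<in>{1..n}. fm i \<Delta> x)"
    and NF_def: "NF = Min {N i | i. i \<in> {1..n}}"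
    and KF_def: "KF = (\<Sum>i\<in>{1..n}. (\<Prod>j\<in>{1..n} - {i}. \<bar>f j x0\<bar>) * \<kappa> i * \<Delta>max powr (N i - NF))"
  shows "(\<forall>\<Delta>\<in>{0<..\<Delta>max}. norm (gradient F x0 - gradient (Fm \<Delta>) x0) \<le> KF * \<Delta> powr NF)
       \<and> gradient_accuracy \<Delta>max Fm F x0 NF"
proof -
  have acc: "\<kappa> i \<ge> 0" "f i differentiable (at x0)"
    "\<And>\<Delta>. \<Delta> \<in> {0<..\<Delta>max} \<Longrightarrow> norm (gradient (f i) x0 - gradient (fm i \<Delta>) x0) \<le> \<kappa> i * \<Delta> powr N i"
    if "i \<in> {1..n}" for i
    using assms(7)[OF that] by (auto simp: gradient_accuracy_const_def)
  have fm: "fm i \<Delta> differentiable (at x)" if "i \<in> {1..n}" "\<Delta> \<in> {0<..\<Delta>max}" for i \<Delta> x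
    using assms(4) that by (auto simp: differentiable_models_def)
  have exact: "fm i \<Delta> x0 = f i x0" if "i \<in> {1..n}" "\<Delta> \<in> {0<..\<Delta>max}" for i \<Delta>
    using assms(5) that by (auto simp: exact_function_accuracy_def)
  \<comment> \<open>In image form, finiteness of the set under \<open>Min\<close> is
    immediate.\<close>
  have NF_image: "NF = Min (N ` {1..n})"
    unfolding NF_def by (rule arg_cong[of _ _ Min]) auto
  have NF_le: "NF \<le> N i" if "i \<in> {1..n}" for i
    unfolding NF_image using that by (intro Min_le) auto
  \<comment> \<open>Here \<open>n \<ge> 1\<close> enters: it makes the set nonempty, so that
    \<open>Min\<close> is attained by some \<open>N i\<close>.\<close>
  have NF_nonneg: "NF \<ge> 0"
    unfolding NF_image using assms(1,6) by (subst Min_ge_iff) auto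
  have KF_nonneg: "KF \<ge> 0"
    unfolding KF_def using acc(1) by (intro sum_nonneg mult_nonneg_nonneg prod_nonneg) auto
  have bound: "norm (gradient F x0 - gradient (Fm \<Delta>) x0) \<le> KF * \<Delta> powr NF"
    if \<Delta>: "\<Delta> \<in> {0<..\<Delta>max}" for \<Delta>
  proof -
    have "norm (gradient F x0 - gradient (Fm \<Delta>) x0)
        \<le> (\<Sum>i\<in>{1..n}. (\<Prod>j\<in>{1..n} - {i}. \<bar>f j x0\<bar>) * (\<kappa> i * \<Delta> powr N i))"
      unfolding F_def Fm_def using \<Delta> acc(2,3) fm exact by (intro norm_gradient_prod_diff_le)
    also have "\<dots> \<le> (\<Sum>i\<in>{1..n}. (\<Prod>j\<in>{1..n} - {i}. \<bar>f j x0\<bar>) *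
        (\<kappa> i * (\<Delta>max powr (N i - NF) * \<Delta> powr NF)))"
      using \<Delta> acc(1) NF_le
      by (intro sum_mono mult_left_mono powr_le_powr_diff_mult prod_nonneg) auto
    also have "\<dots> = KF * \<Delta> powr NF"
      by (simp add: KF_def sum_distrib_right mult.assoc)
    finally show ?thesis .
  qed
  have "F differentiable (at x0)"
    unfolding F_def using acc(2) by (rule differentiable_prod_at)
  moreover have "differentiable_models \<Delta>max Fm"
    unfolding differentiable_models_def Fm_def using fm by (intro ballI allI differentiable_prod_at)
  \<comment> \<open>\<open>KF\<close> does not depend on \<open>\<Delta>\<close>, so it is itself
    the witness for the existential in \<open>gradient_accuracy\<close>.\<close>
  ultimately have "gradient_accuracy_const \<Delta>max Fm F x0 NF KF"
    using NF_nonneg KF_nonneg bound by (simp add: gradient_accuracy_const_def)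
  with bound show ?thesis
    by (auto simp: gradient_accuracy_def)
qed

end
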